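(* The uplink power control algorithm defined in the context is convergent in the objective, since the objective $f(\boldsymbol{\mathcal{E}}_{\mathsf u},\boldsymbol\varpi_{\mathsf u})$ defined in the context is bounded above and monotonically non-decreasing after each iteration of the algorithm.
   Context: **Data.** $\mathcal{U}_{\mathsf u}$ and $\mathcal{U}_{\mathsf d}$ are the disjoint finite sets of uplink and downlink users; $\mathcal{A}_{\mathsf u}$ and $\mathcal{A}_{\mathsf d}$ are the disjoint finite sets of access points (APs) scheduled in uplink and downlink. Each AP has $N$ antennas, and the pilot length $\tau_p$ satisfies $N\ge\tau_p+1$. $\mathcal{P}_{l(k)}$ is the set of users (including $k$) that use the same pilot as user $k$. $\beta_{mk}>0$ is the large-scale fading coefficient between AP $m$ and user $k$, $\mathcal{E}_{p,k}$ is the pilot power of user $k$, $N_0$ is the noise variance, and $$\alpha_{mk}^2=\frac{\tau_p\mathcal{E}_{p,k}\beta_{mk}^2}{\tau_p\sum_{n\in\mathcal{P}_{l(k)}}\mathcal{E}_{p,n}\beta_{mn}+N_0}.$$ $\omega_{mk}$ ($m\in\mathcal{A}_{\mathsf u}$, $k\in\mathcal{U}_{\mathsf u}$) are the combining weights at the central processing unit; any choice is allowed, and they are held fixed. $\mathcal{E}_{\mathsf d}$ is the downlink power of an AP, $\kappa_{jn}$ ($j\in\mathcal{A}_{\mathsf d}$, $n\in\mathcal{U}_{\mathsf d}$) are the downlink power control coefficients, which are given and fixed, and $\zeta_{mj}$ is the variance of the entries of the residual interference channel from AP $j$ to AP $m$. The effective noise, which does not depend on the uplink powers, is $$\sigma^2_{\mathsf{eff.},\mathsf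 u,k}=N\sum_{n\in\mathcal{U}_{\mathsf d}}\sum_{m\in\mathcal{A}_{\mathsf u}}\sum_{j\in\mathcal{A}_{\mathsf d}}\mathcal{E}_{\mathsf d}\kappa_{jn}^2\zeta_{mj}|\omega_{mk}^*|^2\alpha_{mk}^2+N_0\sum_{m\in\mathcal{A}_{\mathsf u}}|\omega_{mk}^*|^2\alpha_{mk}^2.$$ The variables are the uplink transmit powers $\boldsymbol{\mathcal{E}}_{\mathsf u}=(\mathcal{E}_{\mathsf u,k})_{k\in\mathcal{U}_{\mathsf u}}$, constrained by $0\le\mathcal{E}_{\mathsf u,k}\le\mathcal{E}_{\mathsf u}$ for all $k\in\mathcal{U}_{\mathsf u}$, where the scalar $\mathcal{E}_{\mathsf u}$ is the maximum power. Put $$\mathsf{G}_{\mathsf u,k}(\boldsymbol{\mathcal{E}}_{\mathsf u})=(N-\tau_p)\mathcal{E}_{\mathsf u,k}\Big(\sum_{m\in\mathcal{A}_{\mathsf u}}\omega_{mk}^*\alpha_{mk}^2\Big)^2,$$ $$\mathsf{I}_{\mathsf u,k}(\boldsymbol{\mathcal{E}}_{\mathsf u})=\sum_{k'\in\mathcal{U}_{\mathsf u}}\mathcal{E}_{\mathsf u,k'}\sum_{m\in\mathcal{A}_{\mathsf u}}|\omega_{mk}^*|^2\alpha_{mk}^2(\beta_{mk'}-\alpha_{mk'}^2)+(N-\tau_p)\sum_{i\in(\mathcal{P}_{l(k)}\cap\,\mathcal{U}_{\mathsf u})\setminus\{k\}}\mathcal{E}_{\mathsf u,i}\Big(\sum_{m\in\mathcal{A}_{\mathsf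 u}}\omega_{mk}^*\alpha_{mi}^2\Big)^2+\sigma^2_{\mathsf{eff.},\mathsf u,k}.$$ The original problem is to maximize $\sum_{k\in\mathcal{U}_{\mathsf u}}\log\big(1+\mathsf{G}_{\mathsf u,k}(\boldsymbol{\mathcal{E}}_{\mathsf u})/\mathsf{I}_{\mathsf u,k}(\boldsymbol{\mathcal{E}}_{\mathsf u})\big)$ subject to the power constraints. **Objectives.** With auxiliary variables $\boldsymbol\varpi_{\mathsf u}=(\varpi_{\mathsf u,k})_{k\in\mathcal{U}_{\mathsf u}}$, $$f(\boldsymbol{\mathcal{E}}_{\mathsf u},\boldsymbol\varpi_{\mathsf u})=\sum_{k\in\mathcal{U}_{\mathsf u}}\ln(1+\varpi_{\mathsf u,k})-\sum_{k\in\mathcal{U}_{\mathsf u}}\varpi_{\mathsf u,k}+\sum_{k\in\mathcal{U}_{\mathsf u}}\frac{(1+\varpi_{\mathsf u,k})\mathsf{G}_{\mathsf u,k}(\boldsymbol{\mathcal{E}}_{\mathsf u})}{\mathsf{G}_{\mathsf u,k}(\boldsymbol{\mathcal{E}}_{\mathsf u})+\mathsf{I}_{\mathsf u,k}(\boldsymbol{\mathcal{E}}_{\mathsf u})}.$$ For fixed $\boldsymbol\varpi_{\mathsf u}$, with further auxiliary variables $\tilde{\boldsymbol\varpi}_{\mathsf u}=(\tilde\varpi_{\mathsf u,k})_{k\in\mathcal{U}_{\mathsf u}}$, the quadratic-transform surrogate is $$f(\boldsymbol{\mathcal{E}}_{\mathsf u},\tilde{\boldsymbol\varpi}_{\mathsf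 u})=\sum_{k\in\mathcal{U}_{\mathsf u}}2\tilde\varpi_{\mathsf u,k}\sqrt{(1+\varpi_{\mathsf u,k})\mathsf{G}_{\mathsf u,k}(\boldsymbol{\mathcal{E}}_{\mathsf u})}-\sum_{k\in\mathcal{U}_{\mathsf u}}\tilde\varpi_{\mathsf u,k}^2\big(\mathsf{G}_{\mathsf u,k}(\boldsymbol{\mathcal{E}}_{\mathsf u})+\mathsf{I}_{\mathsf u,k}(\boldsymbol{\mathcal{E}}_{\mathsf u})\big)+\mathsf{c}_{\boldsymbol\varpi_{\mathsf u}},$$ where $\mathsf{c}_{\boldsymbol\varpi_{\mathsf u}}$ depends only on $\boldsymbol\varpi_{\mathsf u}$. **Algorithm.** Initialize $\boldsymbol{\mathcal{E}}_{\mathsf u}^0$ and $i=0$. While the change $|f(\boldsymbol{\mathcal{E}}_{\mathsf u},\boldsymbol\varpi_{\mathsf u})^{i+1}-f(\boldsymbol{\mathcal{E}}_{\mathsf u},\boldsymbol\varpi_{\mathsf u})^{i}|$ of the objective between successive iterations is at least a threshold $\delta_{\mathsf u}$, perform for all $k\in\mathcal{U}_{\mathsf u}$: 1. $\varpi_{\mathsf u,k}^{i+1}=\mathsf{G}_{\mathsf u,k}(\boldsymbol{\mathcal{E}}_{\mathsf u}^i)/\mathsf{I}_{\mathsf u,k}(\boldsymbol{\mathcal{E}}_{\mathsf u}^i)$. 2. $\tilde\varpi_{\mathsf u,k}^{i+1}=\dfrac{\sqrt{(1+\varpi_{\mathsf u,k}^{i+1})\mathsf{G}_{\mathsf u,k}(\boldsymbol{\mathcal{E}}_{\mathsf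 u}^i)}}{\mathsf{G}_{\mathsf u,k}(\boldsymbol{\mathcal{E}}_{\mathsf u}^i)+\mathsf{I}_{\mathsf u,k}(\boldsymbol{\mathcal{E}}_{\mathsf u}^i)}$ (from $\partial f(\boldsymbol{\mathcal{E}}_{\mathsf u},\tilde{\boldsymbol\varpi}_{\mathsf u})/\partial\tilde\varpi_{\mathsf u,k}=0$). 3. $\mathcal{E}_{\mathsf u,k}^{i+1}=\min\{E_k,\mathcal{E}_{\mathsf u}\}$, where $E_k$ is the following value, presented as the one obtained by setting $\partial f(\boldsymbol{\mathcal{E}}_{\mathsf u},\tilde{\boldsymbol\varpi}_{\mathsf u})/\partial\mathcal{E}_{\mathsf u,k}=0$ at $\boldsymbol\varpi_{\mathsf u}^{i+1},\tilde{\boldsymbol\varpi}_{\mathsf u}^{i+1}$: $$E_k=\frac{\Big(\tilde\varpi_{\mathsf u,k}^{i+1}\sqrt{1+\varpi_{\mathsf u,k}^{i+1}}\Big)^2(N-\tau_p)\Big(\sum_{m\in\mathcal{A}_{\mathsf u}}\omega_{mk}^*\alpha_{mk}^2\Big)^2}{\Big[\sum_{n\in\mathcal{U}_{\mathsf u}}(\tilde\varpi_{\mathsf u,n}^{i+1})^2\Big\{(N-\tau_p)\Big(\sum_{m\in\mathcal{A}_{\mathsf u}}\omega_{mn}^*\alpha_{mk}^2\Big)^2+\sum_{m\in\mathcal{A}_{\mathsf u}}|\omega_{mn}^*|^2\alpha_{mn}^2(\beta_{mk}-\alpha_{mk}^2)\Big\}\Big]^2}.$$ Then replace $i$ by $i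+1$.
   Formalization: In step 3, E_k is the actual zero of the surrogate's derivative: the coherent term in the denominator is summed only over users n sharing user k's pilot, not over all uplink users as printed, since with the printed formula the objective can decrease. *)

theory Defs
  imports "HOL-Analysis.Analysis"
begin

text \<open>
  Users have type \<open>'u\<close> and access points type \<open>'a\<close>.  The field \<open>pilot\<close> assigns to each user
  the index of its pilot.  Weights are complex, and the square of a weighted sum of weights is
  read as the squared modulus; for real weights this is the ordinary square.
\<close>

record ('a, 'u) network =
  UL :: "'u set"
  DL :: "'u set"
  APu :: "'a set"
  APd :: "'a set"
  Nant :: nat
  taup :: nat
  pilot :: "'u \<Rightarrow> nat"
  beta :: "'a \<Rightarrow> 'u \<Rightarrow> real"
  Epil :: "'u \<Rightarrow> real"
  N0 :: real
  omega :: "'a \<Rightarrow> 'u \<Rightarrow> complex"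
  Edl :: real
  kappa :: "'a \<Rightarrow> 'u \<Rightarrow> real"
  zeta :: "'a \<Rightarrow> 'a \<Rightarrow> real"
  Emax :: real

definition network :: "('a, 'u) network \<Rightarrow> bool" where
  "network S \<longleftrightarrow>
     finite (UL S) \<and> finite (DL S) \<and> UL S \<inter> DL S = {} \<and>
     finite (APu S) \<and> finite (APd S) \<and> APu S \<inter> APd S = {} \<and>
     Nant S \<ge> taup S + 1 \<and>
     (\<forall>m \<in> APu S \<union> APd S. \<forall>k \<in> UL S \<union> DL S. beta S m k > 0) \<and>
     (\<forall>k \<in> UL S \<union> DL S. Epil S k \<ge> 0) \<and>
     N0 S > 0 \<and>
     Edl S \<ge> 0 \<and>
     (\<forall>m \<in> APu S. \<forall>j \<in> APd S. zeta S m j \<ge> 0)"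

definition copilot :: "('a, 'u) network \<Rightarrow> 'u \<Rightarrow> 'u set" where
  "copilot S k = {n \<in> UL S \<union> DL S. pilot S n = pilot S k}"

definition alpha2 :: "('a, 'u) network \<Rightarrow> 'a \<Rightarrow> 'u \<Rightarrow> real" where
  "alpha2 S m k =
     real (taup S) * Epil S k * (beta S m k)\<^sup>2 /
     (real (taup S) * (\<Sum>n \<in> copilot S k. Epil S n * beta S m n) + N0 S)"

text \<open>The squared modulus of \<open>\<Sum>m. \<omega>\<^sup>*\<^sub>m\<^sub>n \<alpha>\<^sup>2\<^sub>m\<^sub>k\<close>, with the weights of user \<open>n\<close> and the
  coefficients of user \<open>k\<close>.\<close>

definition coh :: "('a, 'u) network \<Rightarrow> 'u \<Rightarrow> 'u \<Rightarrow> real" where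
  "coh S n k = (cmod (\<Sum>m \<in> APu S. cnj (omega S m n) * complex_of_real (alpha2 S m k)))\<^sup>2"

definition noncoh :: "('a, 'u) network \<Rightarrow> 'u \<Rightarrow> 'u \<Rightarrow> real" where
  "noncoh S n k =
     (\<Sum>m \<in> APu S. (cmod (cnj (omega S m n)))\<^sup>2 * alpha2 S m n * (beta S m k - alpha2 S m k))"

definition eff_noise :: "('a, 'u) network \<Rightarrow> 'u \<Rightarrow> real" where
  "eff_noise S k =
     real (Nant S) *
       (\<Sum>n \<in> DL S. \<Sum>m \<in> APu S. \<Sum>j \<in> APd S.
          Edl S * (kappa S j n)\<^sup>2 * zeta S m j * (cmod (cnj (omega S m k)))\<^sup>2 * alpha2 S m k)
     + N0 S * (\<Sum>m \<in> APu S. (cmod (cnj (omega S m k)))\<^sup>2 * alpha2 S m k)"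

definition gain :: "('a, 'u) network \<Rightarrow> ('u \<Rightarrow> real) \<Rightarrow> 'u \<Rightarrow> real" where
  "gain S E k = (real (Nant S) - real (taup S)) * E k * coh S k k"

definition interf :: "('a, 'u) network \<Rightarrow> ('u \<Rightarrow> real) \<Rightarrow> 'u \<Rightarrow> real" where
  "interf S E k =
     (\<Sum>k' \<in> UL S. E k' * noncoh S k k')
     + (real (Nant S) - real (taup S)) *
         (\<Sum>i \<in> (copilot S k \<inter> UL S) - {k}. E i * coh S k i)
     + eff_noise S k"

definition feasible :: "('a, 'u) network \<Rightarrow> ('u \<Rightarrow> real) \<Rightarrow> bool" where
  "feasible S E \<longleftrightarrow> (\<forall>k \<in> UL S. 0 \<le> E k \<and> E k \<le> Emax S)"

definition objective :: "('a, 'u) network \<Rightarrow> ('u \<Rightarrow> real) \<Rightarrow> ('u \<Rightarrow> real) \<Rightarrow> real" where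
  "objective S E w =
     (\<Sum>k \<in> UL S. ln (1 + w k)) - (\<Sum>k \<in> UL S. w k)
     + (\<Sum>k \<in> UL S. (1 + w k) * gain S E k / (gain S E k + interf S E k))"

definition surrogate ::
  "('a, 'u) network \<Rightarrow> ('u \<Rightarrow> real) \<Rightarrow> ('u \<Rightarrow> real) \<Rightarrow> ('u \<Rightarrow> real) \<Rightarrow> real" where
  "surrogate S w E v =
     (\<Sum>k \<in> UL S. 2 * v k * sqrt ((1 + w k) * gain S E k))
     - (\<Sum>k \<in> UL S. (v k)\<^sup>2 * (gain S E k + interf S E k))
     + ((\<Sum>k \<in> UL S. ln (1 + w k)) - (\<Sum>k \<in> UL S. w k))"

definition sinr_step :: "('a, 'u) network \<Rightarrow> ('u \<Rightarrow> real) \<Rightarrow> 'u \<Rightarrow> real" where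
  "sinr_step S E k = gain S E k / interf S E k"

definition quad_step :: "('a, 'u) network \<Rightarrow> ('u \<Rightarrow> real) \<Rightarrow> ('u \<Rightarrow> real) \<Rightarrow> 'u \<Rightarrow> real" where
  "quad_step S w E k = sqrt ((1 + w k) * gain S E k) / (gain S E k + interf S E k)"

text \<open>
  The zero of the partial derivative of the surrogate with respect to the power of user \<open>k\<close>
  (see \<open>surrogate_stationary\<close> below).  The coherent term occurs only for those \<open>n\<close> that share
  the pilot of \<open>k\<close>, because only the interference of those users contains \<open>E k * coh S n k\<close>.
  If it were added for all \<open>n\<close>, the value would not be a stationary point and the
  iteration could decrease the objective.
  If the surrogate has no stationary point because \<open>v k = 0\<close> or \<open>coh S k k = 0\<close>, the value is 0.
\<close>

definition stationary_power :: "('a, 'u) network \<Rightarrow> ('u \<Rightarrow> real) \<Rightarrow> ('u \<Rightarrow> real) \<Rightarrow> 'u \<Rightarrow> real" where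
  "stationary_power S w v k =
     (v k * sqrt (1 + w k))\<^sup>2 * (real (Nant S) - real (taup S)) * coh S k k /
     (\<Sum>n \<in> UL S. (v n)\<^sup>2 *
        ((if n \<in> copilot S k then (real (Nant S) - real (taup S)) * coh S n k else 0)
         + noncoh S n k))\<^sup>2"

definition power_step :: "('a, 'u) network \<Rightarrow> ('u \<Rightarrow> real) \<Rightarrow> 'u \<Rightarrow> real" where
  "power_step S E =
     (let w = sinr_step S E; v = quad_step S w E
      in (\<lambda>k. min (stationary_power S w v k) (Emax S)))"

primrec powers :: "('a, 'u) network \<Rightarrow> ('u \<Rightarrow> real) \<Rightarrow> nat \<Rightarrow> 'u \<Rightarrow> real" where
  "powers S E0 0 = E0"
| "powers S E0 (Suc i) = power_step S (powers S E0 i)"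

text \<open>The initial \<open>w0\<close> enters only the objective value before the first iteration, with
  which the stopping rule compares the value after it.\<close>

primrec auxvars ::
  "('a, 'u) network \<Rightarrow> ('u \<Rightarrow> real) \<Rightarrow> ('u \<Rightarrow> real) \<Rightarrow> nat \<Rightarrow> 'u \<Rightarrow> real" where
  "auxvars S E0 w0 0 = w0"
| "auxvars S E0 w0 (Suc i) = sinr_step S (powers S E0 i)"

definition objective_seq ::
  "('a, 'u) network \<Rightarrow> ('u \<Rightarrow> real) \<Rightarrow> ('u \<Rightarrow> real) \<Rightarrow> nat \<Rightarrow> real" where
  "objective_seq S E0 w0 i = objective S (powers S E0 i) (auxvars S E0 w0 i)"

lemma coh_nonneg: "coh S n k \<ge> 0"
  by (simp add: coh_def)

lemma alpha2_bounds:
  assumes "network S" "m \<in> APu S" "k \<in> UL S"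
  shows "0 \<le> alpha2 S m k" "alpha2 S m k \<le> beta S m k"
proof -
  let ?s = "\<Sum>n \<in> copilot S k. Epil S n * beta S m n"
  have fin: "finite (copilot S k)" and kin: "k \<in> copilot S k"
    using assms by (auto simp: network_def copilot_def)
  have nn: "Epil S n * beta S m n \<ge> 0" if "n \<in> copilot S k" for n
  proof (rule mult_nonneg_nonneg)
    show "0 \<le> Epil S n"
      using assms that by (auto simp: network_def copilot_def)
    have "0 < beta S m n"
      using assms that by (auto simp: network_def copilot_def)
    then show "0 \<le> beta S m n" by simp
  qed
  have le: "Epil S k * beta S m k \<le> ?s"
    by (rule member_le_sum[OF kin _ fin]) (use nn in auto)
  have b: "beta S m k > 0" "Epil S k \<ge> 0" "N0 S > 0"
    using assms by (auto simp: network_def)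
  have s0: "?s \<ge> 0" by (rule sum_nonneg) (use nn in auto)
  have d: "real (taup S) * ?s + N0 S > 0"
    using s0 b by (simp add: add_nonneg_pos)
  show "0 \<le> alpha2 S m k"
    unfolding alpha2_def using d b by (intro divide_nonneg_pos mult_nonneg_nonneg) auto
  have "real (taup S) * (Epil S k * beta S m k) \<le> real (taup S) * ?s + N0 S"
    using mult_left_mono[OF le, of "real (taup S)"] b by linarith
  then have "beta S m k * (real (taup S) * (Epil S k * beta S m k))
      \<le> beta S m k * (real (taup S) * ?s + N0 S)"
    using b by (intro mult_left_mono) auto
  then show "alpha2 S m k \<le> beta S m k"
    unfolding alpha2_def using d by (simp add: pos_divide_le_eq power2_eq_square mult_ac)
qed

lemma noncoh_nonneg:
  assumes "network S" "n \<in> UL S" "k \<in> UL S"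
  shows "noncoh S n k \<ge> 0"
proof (unfold noncoh_def, rule sum_nonneg)
  fix m assume m: "m \<in> APu S"
  show "0 \<le> (cmod (cnj (omega S m n)))\<^sup>2 * alpha2 S m n * (beta S m k - alpha2 S m k)"
    using alpha2_bounds[OF assms(1) m assms(2)] alpha2_bounds[OF assms(1) m assms(3)]
    by simp
qed

lemma gain_plus_interf_upd:
  assumes S: "network S" and k: "k \<in> UL S" and n: "n \<in> UL S"
  shows "gain S (E(k := x)) n + interf S (E(k := x)) n =
    gain S (E(k := 0)) n + interf S (E(k := 0)) n +
    x * ((if n \<in> copilot S k then (real (Nant S) - real (taup S)) * coh S n k else 0)
         + noncoh S n k)"
proof -
  have fin: "finite (UL S)" using S by (simp add: network_def)
  let ?c = "real (Nant S) - real (taup S)"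
  have split1: "(\<Sum>k' \<in> UL S. (E(k := y)) k' * noncoh S n k')
      = y * noncoh S n k + (\<Sum>k' \<in> UL S - {k}. E k' * noncoh S n k')" for y
    by (subst sum.remove[OF fin k]) (auto intro!: sum.cong)
  have iff: "n \<in> copilot S k \<longleftrightarrow> k \<in> copilot S n"
    using n k by (auto simp: copilot_def)
  let ?J = "(copilot S n \<inter> UL S)"
  have nJ: "n \<in> ?J" and finJ: "finite ?J" using n fin by (auto simp: copilot_def)
  have all: "?c * y n * coh S n n + ?c * (\<Sum>i \<in> ?J - {n}. y i * coh S n i)
      = ?c * (\<Sum>i \<in> ?J. y i * coh S n i)" for y :: "'b \<Rightarrow> real"
    using sum.remove[OF finJ nJ, of "\<lambda>i. y i * coh S n i"] by (simp add: algebra_simps)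
  have split2: "(\<Sum>i \<in> ?J. (E(k := y)) i * coh S n i)
      = (if k \<in> copilot S n then y * coh S n k else 0) + (\<Sum>i \<in> ?J - {k}. E i * coh S n i)" for y
  proof (cases "k \<in> copilot S n")
    case True
    then have kJ: "k \<in> ?J" using k by simp
    show ?thesis using True by (subst sum.remove[OF finJ kJ]) (auto intro!: sum.cong)
  next
    case False
    then show ?thesis by (auto intro!: sum.cong)
  qed
  have expand: "gain S (E(k := y)) n + interf S (E(k := y)) n =
      ?c * ((if k \<in> copilot S n then y * coh S n k else 0) + (\<Sum>i \<in> ?J - {k}. E i * coh S n i))
      + (y * noncoh S n k + (\<Sum>k' \<in> UL S - {k}. E k' * noncoh S n k')) + eff_noise S n" for y
  proof -
    have "gain S (E(k := y)) n + interf S (E(k := y)) n =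
        (?c * (E(k := y)) n * coh S n n + ?c * (\<Sum>i \<in> ?J - {n}. (E(k := y)) i * coh S n i))
        + (\<Sum>k' \<in> UL S. (E(k := y)) k' * noncoh S n k') + eff_noise S n"
      unfolding gain_def interf_def by (simp only: ac_simps)
    then show ?thesis by (simp only: all split1 split2)
  qed
  show ?thesis
    unfolding expand iff by (simp add: algebra_simps)
qed

lemma surrogate_stationary:
  assumes S: "network S" and k: "k \<in> UL S"
    and v: "v k > 0" and w: "w k > -1" and c: "coh S k k \<noteq> 0"
  shows "stationary_power S w v k > 0"
    and "((\<lambda>x. surrogate S w (E(k := x)) v) has_real_derivative 0)
           (at (stationary_power S w v k))"
proof -
  have fin: "finite (UL S)" using S by (simp add: network_def)
  let ?c = "real (Nant S) - real (taup S)"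
  have cpos: "?c > 0" using S by (simp add: network_def)
  have cohpos: "coh S k k > 0" using c coh_nonneg[of S k k] by linarith
  define q where "q n = (v n)\<^sup>2 * ((if n \<in> copilot S k then ?c * coh S n k else 0) + noncoh S n k)" for n
  define D where "D = (\<Sum>n \<in> UL S. q n)"
  define a where "a = v k * sqrt ((1 + w k) * ?c * coh S k k)"
  define X where "X = stationary_power S w v k"
  have qnn: "q n \<ge> 0" if "n \<in> UL S" for n
    unfolding q_def using cpos coh_nonneg[of S n k] noncoh_nonneg[OF S that k]
    by (intro mult_nonneg_nonneg add_nonneg_nonneg) auto
  have kk: "k \<in> copilot S k" using k by (simp add: copilot_def)
  have "q k > 0"
    unfolding q_def using kk cpos cohpos v noncoh_nonneg[OF S k k]
    by (simp add: add_pos_nonneg)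
  then have Dpos: "D > 0"
    unfolding D_def using sum_pos2[OF fin k] qnn by blast
  have apos: "a > 0" unfolding a_def using v w cpos cohpos by simp
  have Xeq: "X = (a / D)\<^sup>2"
    unfolding X_def stationary_power_def a_def D_def q_def
    using w cpos cohpos by (simp add: power_divide power_mult_distrib)
  show Xpos: "stationary_power S w v k > 0"
    using Xeq apos Dpos unfolding X_def by simp
  let ?g = "\<lambda>n x. gain S (E(k := x)) n + interf S (E(k := x)) n"
  define C where "C = (\<Sum>n \<in> UL S - {k}. 2 * v n * sqrt ((1 + w n) * gain S E n))
      - (\<Sum>n \<in> UL S. (v n)\<^sup>2 * ?g n 0)
      + ((\<Sum>n \<in> UL S. ln (1 + w n)) - (\<Sum>n \<in> UL S. w n))"
  have s1: "(\<Sum>n \<in> UL S. 2 * v n * sqrt ((1 + w n) * gain S (E(k := x)) n))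
      = 2 * a * sqrt x + (\<Sum>n \<in> UL S - {k}. 2 * v n * sqrt ((1 + w n) * gain S E n))" for x
  proof -
    have "2 * v k * sqrt ((1 + w k) * gain S (E(k := x)) k) = 2 * a * sqrt x"
      by (simp add: gain_def a_def real_sqrt_mult)
    moreover have "(\<Sum>n \<in> UL S - {k}. 2 * v n * sqrt ((1 + w n) * gain S (E(k := x)) n))
        = (\<Sum>n \<in> UL S - {k}. 2 * v n * sqrt ((1 + w n) * gain S E n))"
      by (rule sum.cong) (auto simp: gain_def)
    ultimately show ?thesis by (simp add: sum.remove[OF fin k])
  qed
  have s2: "(\<Sum>n \<in> UL S. (v n)\<^sup>2 * ?g n x) = (\<Sum>n \<in> UL S. (v n)\<^sup>2 * ?g n 0) + x * D" for x
  proof -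
    have "(\<Sum>n \<in> UL S. (v n)\<^sup>2 * ?g n x) = (\<Sum>n \<in> UL S. (v n)\<^sup>2 * ?g n 0 + x * q n)"
    proof (rule sum.cong[OF refl])
      fix n assume n: "n \<in> UL S"
      show "(v n)\<^sup>2 * ?g n x = (v n)\<^sup>2 * ?g n 0 + x * q n"
        unfolding gain_plus_interf_upd[OF S k n, of E x] q_def by (simp add: algebra_simps)
    qed
    then show ?thesis by (simp add: sum.distrib D_def sum_distrib_left)
  qed
  have eq: "(\<lambda>x. surrogate S w (E(k := x)) v) = (\<lambda>x. 2 * a * sqrt x - x * D + C)"
  proof
    fix x
    show "surrogate S w (E(k := x)) v = 2 * a * sqrt x - x * D + C"
      using s1[of x] s2[of x] unfolding surrogate_def C_def by linarith
  qed
  have sX: "sqrt X = a / D" using Xeq apos Dpos by simp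
  have "((\<lambda>x. 2 * a * sqrt x - x * D + C) has_real_derivative
      (2 * a * (inverse (sqrt X) / 2) - D)) (at X)"
    using Xpos unfolding X_def[symmetric] by (auto intro!: derivative_eq_intros)
  moreover have "2 * a * (inverse (sqrt X) / 2) - D = 0"
    unfolding sX using apos Dpos by (simp add: field_simps)
  ultimately show "((\<lambda>x. surrogate S w (E(k := x)) v) has_real_derivative 0)
           (at (stationary_power S w v k))"
    unfolding eq X_def by simp
qed

end

theory Submission
  imports Defs
begin

text \<open>
  The algorithm is block coordinate ascent by minorization.  For fixed powers, the objective is
  maximized over the auxiliary variables by the signal-to-interference ratios, with value
  \<open>\<Sum>k. ln (1 + G\<^sub>k / I\<^sub>k)\<close>.  For fixed auxiliary variables, the surrogate lies below the objective
  and touches it at the current powers when the second auxiliary variables are those of the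
  algorithm.  The surrogate is a sum of concave functions \<open>2 a\<^sub>k \<surd>E\<^sub>k - D\<^sub>k E\<^sub>k\<close>, one for each
  user, plus a constant, so clipping each stationary point at the maximum power maximizes it over
  the feasible set.  The ratios are bounded because the effective noise of a user vanishes only
  if its gain does.
\<close>

lemma ln_dual_le:
  fixes w g i :: real
  assumes "w > -1" "g \<ge> 0" "i \<ge> 0" "i = 0 \<Longrightarrow> g = 0"
  shows "ln (1 + w) - w + (1 + w) * g / (g + i) \<le> ln (1 + g / i)"
proof (cases "g = 0")
  case True
  then show ?thesis using ln_add_one_self_le_self2[of w] assms by simp
next
  case False
  then have pos: "g > 0" "i > 0" using assms by force+
  let ?r = "i / (g + i)"
  have "ln ((1 + w) * ?r) \<le> (1 + w) * ?r - 1"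
    using assms(1) pos by (intro ln_le_minus_one) simp
  moreover have "ln ((1 + w) * ?r) = ln (1 + w) - ln (1 + g / i)"
  proof -
    have "1 + g / i = inverse ?r" using pos by (simp add: field_simps)
    moreover have "ln ((1 + w) * ?r) = ln (1 + w) + ln ?r"
      using assms(1) pos by (intro ln_mult_pos) auto
    moreover have "ln (inverse ?r) = - ln ?r" by (rule ln_inverse)
    ultimately show ?thesis by simp
  qed
  moreover have "(1 + w) * ?r - 1 = w - (1 + w) * g / (g + i)"
    using pos by (simp add: field_simps)
  ultimately show ?thesis by linarith
qed

lemma ln_dual_eq:
  fixes g i :: real
  assumes "g \<ge> 0" "i \<ge> 0" "i = 0 \<Longrightarrow> g = 0"
  shows "ln (1 + g / i) - g / i + (1 + g / i) * g / (g + i) = ln (1 + g / i)"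
proof (cases "i = 0")
  case False
  then have "i > 0" "g + i > 0" using assms by auto
  moreover from this have "1 + g / i = (g + i) / i" by (simp add: field_simps)
  ultimately have "(1 + g / i) * g / (g + i) = g / i" by simp
  then show ?thesis by simp
qed (use assms in auto)

lemma quadratic_transform_le:
  fixes v a b :: real
  assumes "a \<ge> 0" "b \<ge> 0" "b = 0 \<Longrightarrow> a = 0"
  shows "2 * v * sqrt a - v\<^sup>2 * b \<le> a / b"
proof (cases "b = 0")
  case False
  then have b: "b > 0" using assms by simp
  have "0 \<le> (sqrt a - v * b)\<^sup>2" by simp
  also have "\<dots> = a - (2 * v * sqrt a - v\<^sup>2 * b) * b"
    using assms(1) by (simp add: power2_diff power_mult_distrib algebra_simps power2_eq_square)
  finally show ?thesis using b by (simp add: pos_le_divide_eq)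
qed (use assms in auto)

lemma quadratic_transform_eq:
  fixes a b :: real
  assumes "a \<ge> 0"
  shows "2 * (sqrt a / b) * sqrt a - (sqrt a / b)\<^sup>2 * b = a / b"
  using assms by (cases "b = 0") (simp_all add: power2_eq_square field_simps)

lemma clipped_sqrt_maximizer:
  fixes a d p y :: real
  assumes "a \<ge> 0" "d \<ge> 0" "d = 0 \<Longrightarrow> a = 0" "0 \<le> y" "y \<le> p"
  defines "x \<equiv> min ((a / d)\<^sup>2) p"
  shows "2 * a * sqrt y - y * d \<le> 2 * a * sqrt x - x * d"
proof (cases "d = 0")
  case False
  then have d: "d > 0" using assms by simp
  let ?s = "sqrt x" and ?t = "sqrt y"
  have "0 \<le> x" using assms by (simp add: x_def)
  then have sq: "?s\<^sup>2 = x" "?t\<^sup>2 = y" using assms by auto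
  have diff: "2 * a * ?s - ?s\<^sup>2 * d - (2 * a * ?t - ?t\<^sup>2 * d) = (?s - ?t) * (2 * a - d * (?s + ?t))"
    by (simp add: algebra_simps power2_eq_square)
  have "(?s - ?t) * (2 * a - d * (?s + ?t)) \<ge> 0"
  proof (cases "(a / d)\<^sup>2 \<le> p")
    case True
    then have "?s = a / d" using assms d by (simp add: x_def min_absorb1)
    then have "a = d * ?s" using d by simp
    then have "(?s - ?t) * (2 * a - d * (?s + ?t)) = d * (?s - ?t)\<^sup>2"
      by (simp add: algebra_simps power2_eq_square)
    then show ?thesis using d by simp
  next
    case False
    then have xp: "x = p" by (simp add: x_def)
    then have ts: "?t \<le> ?s" using assms by simp
    have "?s \<le> sqrt ((a / d)\<^sup>2)" using False xp by (intro real_sqrt_le_mono) simp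
    also have "\<dots> = a / d" using assms by simp
    finally have "d * ?s \<le> a" using d by (simp add: pos_le_divide_eq mult.commute)
    moreover have "d * ?t \<le> d * ?s" using ts d by simp
    ultimately have "0 \<le> 2 * a - d * (?s + ?t)" by (simp add: algebra_simps)
    then show ?thesis using ts by simp
  qed
  then show ?thesis using diff sq by simp
qed (use assms in simp)

lemma noise_coeff_nonneg:
  assumes "network S" "k \<in> UL S" "m \<in> APu S"
  shows "0 \<le> (cmod (cnj (omega S m k)))\<^sup>2 * alpha2 S m k"
  using alpha2_bounds[OF assms(1,3,2)] by simp

lemma eff_noise_ge:
  assumes S: "network S" and k: "k \<in> UL S"
  shows "N0 S * (\<Sum>m \<in> APu S. (cmod (cnj (omega S m k)))\<^sup>2 * alpha2 S m k) \<le> eff_noise S k"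
proof -
  have "0 \<le> Edl S * (kappa S j n)\<^sup>2 * zeta S m j * (cmod (cnj (omega S m k)))\<^sup>2 * alpha2 S m k"
    if "m \<in> APu S" "j \<in> APd S" for n m j
    using S that alpha2_bounds[OF S that(1) k]
    by (intro mult_nonneg_nonneg) (auto simp: network_def)
  then have "0 \<le> real (Nant S) * (\<Sum>n \<in> DL S. \<Sum>m \<in> APu S. \<Sum>j \<in> APd S.
      Edl S * (kappa S j n)\<^sup>2 * zeta S m j * (cmod (cnj (omega S m k)))\<^sup>2 * alpha2 S m k)"
    by (intro mult_nonneg_nonneg[OF of_nat_0_le_iff] sum_nonneg)
  then show ?thesis by (simp add: eff_noise_def)
qed

lemma eff_noise_nonneg:
  assumes "network S" "k \<in> UL S"
  shows "0 \<le> eff_noise S k"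
proof -
  have "0 \<le> N0 S * (\<Sum>m \<in> APu S. (cmod (cnj (omega S m k)))\<^sup>2 * alpha2 S m k)"
    using assms(1) by (intro mult_nonneg_nonneg sum_nonneg noise_coeff_nonneg[OF assms])
      (auto simp: network_def)
  then show ?thesis using eff_noise_ge[OF assms] by linarith
qed

lemma coh_eq_0_if_eff_noise_eq_0:
  assumes S: "network S" and k: "k \<in> UL S" and "eff_noise S k = 0"
  shows "coh S k k = 0"
proof -
  let ?t = "\<lambda>m. (cmod (cnj (omega S m k)))\<^sup>2 * alpha2 S m k"
  have fin: "finite (APu S)" and N0: "N0 S > 0" using S by (auto simp: network_def)
  have "sum ?t (APu S) \<le> 0"
    using eff_noise_ge[OF S k] assms(3) N0 by (simp add: mult_le_0_iff)
  then have "sum ?t (APu S) = 0"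
    using noise_coeff_nonneg[OF S k] by (intro antisym sum_nonneg) auto
  then have "\<forall>m \<in> APu S. ?t m = 0"
    using sum_nonneg_eq_0_iff[OF fin, of ?t] noise_coeff_nonneg[OF S k] by blast
  then show ?thesis unfolding coh_def by (auto intro!: sum.neutral)
qed

lemma antenna_margin_pos: "network S \<Longrightarrow> real (Nant S) - real (taup S) > 0"
  by (simp add: network_def)

lemma gain_nonneg:
  assumes "network S" "feasible S E" "k \<in> UL S"
  shows "0 \<le> gain S E k"
  using antenna_margin_pos[OF assms(1)] assms(2,3) coh_nonneg[of S k k]
  unfolding gain_def feasible_def by (intro mult_nonneg_nonneg) auto

lemma interf_ge_eff_noise:
  assumes "network S" "feasible S E" "k \<in> UL S"
  shows "eff_noise S k \<le> interf S E k"
proof -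
  have "0 \<le> (\<Sum>k' \<in> UL S. E k' * noncoh S k k')"
    using assms noncoh_nonneg
    by (intro sum_nonneg mult_nonneg_nonneg) (auto simp: feasible_def)
  moreover have "0 \<le> (real (Nant S) - real (taup S)) *
      (\<Sum>i \<in> (copilot S k \<inter> UL S) - {k}. E i * coh S k i)"
    using antenna_margin_pos[OF assms(1)] assms coh_nonneg
    by (intro mult_nonneg_nonneg sum_nonneg) (auto simp: feasible_def)
  ultimately show ?thesis by (simp add: interf_def)
qed

lemma interf_nonneg:
  assumes "network S" "feasible S E" "k \<in> UL S"
  shows "0 \<le> interf S E k"
  using interf_ge_eff_noise[OF assms] eff_noise_nonneg[OF assms(1,3)] by linarith

lemma gain_eq_0_if_interf_eq_0:
  assumes "network S" "feasible S E" "k \<in> UL S" "interf S E k = 0"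
  shows "gain S E k = 0"
proof -
  have "eff_noise S k = 0"
    using interf_ge_eff_noise[OF assms(1-3)] eff_noise_nonneg[OF assms(1,3)] assms(4) by linarith
  then show ?thesis using coh_eq_0_if_eff_noise_eq_0[OF assms(1,3)] by (simp add: gain_def)
qed

lemma sinr_step_nonneg:
  assumes "network S" "feasible S E" "k \<in> UL S"
  shows "0 \<le> sinr_step S E k"
  using gain_nonneg[OF assms] interf_nonneg[OF assms] by (simp add: sinr_step_def)

lemma sinr_step_le:
  assumes S: "network S" and E: "feasible S E" and k: "k \<in> UL S"
  shows "sinr_step S E k \<le> (real (Nant S) - real (taup S)) * Emax S * coh S k k / eff_noise S k"
proof (cases "eff_noise S k = 0")
  case True
  then show ?thesis
    using coh_eq_0_if_eff_noise_eq_0[OF S k] by (simp add: sinr_step_def gain_def)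
next
  case False
  then have pos: "eff_noise S k > 0" using eff_noise_nonneg[OF S k] by simp
  have "gain S E k \<le> (real (Nant S) - real (taup S)) * Emax S * coh S k k"
    unfolding gain_def using antenna_margin_pos[OF S] E k coh_nonneg[of S k k]
    by (intro mult_right_mono mult_left_mono) (auto simp: feasible_def)
  then show ?thesis
    unfolding sinr_step_def
    using gain_nonneg[OF S E k] pos interf_ge_eff_noise[OF S E k] by (intro frac_le) auto
qed

lemma objective_alt:
  "objective S E w =
    (\<Sum>k \<in> UL S. ln (1 + w k) - w k + (1 + w k) * gain S E k / (gain S E k + interf S E k))"
  by (simp add: objective_def sum.distrib sum_subtractf)

lemma objective_sinr_step:
  assumes "network S" "feasible S E"
  shows "objective S E (sinr_step S E) = (\<Sum>k \<in> UL S. ln (1 + sinr_step S E k))"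
  unfolding objective_alt sinr_step_def
  by (intro sum.cong[OF refl] ln_dual_eq gain_nonneg[OF assms] interf_nonneg[OF assms]
      gain_eq_0_if_interf_eq_0[OF assms])

lemma objective_le_sinr_step:
  assumes "network S" "feasible S E" "\<forall>k \<in> UL S. w k > -1"
  shows "objective S E w \<le> objective S E (sinr_step S E)"
  unfolding objective_sinr_step[OF assms(1,2)] unfolding objective_alt sinr_step_def
  using assms(3)
  by (intro sum_mono ln_dual_le gain_nonneg[OF assms(1,2)] interf_nonneg[OF assms(1,2)]
      gain_eq_0_if_interf_eq_0[OF assms(1,2)]) blast+

lemma objective_le_capacity:
  assumes S: "network S" and E: "feasible S E" and w: "\<forall>k \<in> UL S. w k > -1"
  shows "objective S E w \<le>
    (\<Sum>k \<in> UL S. ln (1 + (real (Nant S) - real (taup S)) * Emax S * coh S k k / eff_noise S k))"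
proof -
  have "objective S E w \<le> (\<Sum>k \<in> UL S. ln (1 + sinr_step S E k))"
    using objective_le_sinr_step[OF S E w] objective_sinr_step[OF S E] by simp
  also have "\<dots> \<le>
      (\<Sum>k \<in> UL S. ln (1 + (real (Nant S) - real (taup S)) * Emax S * coh S k k / eff_noise S k))"
  proof (rule sum_mono)
    fix k assume k: "k \<in> UL S"
    then show "ln (1 + sinr_step S E k)
        \<le> ln (1 + (real (Nant S) - real (taup S)) * Emax S * coh S k k / eff_noise S k)"
      using sinr_step_nonneg[OF S E k] sinr_step_le[OF S E k] by simp
  qed
  finally show ?thesis .
qed

lemma surrogate_alt:
  "surrogate S w E v =
    (\<Sum>k \<in> UL S. 2 * v k * sqrt ((1 + w k) * gain S E k) - (v k)\<^sup>2 * (gain S E k + interf S E k)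
      + (ln (1 + w k) - w k))"
  by (simp add: surrogate_def sum.distrib sum_subtractf)

lemma surrogate_le_objective:
  assumes S: "network S" and E: "feasible S E" and w: "\<forall>k \<in> UL S. w k > -1"
  shows "surrogate S w E v \<le> objective S E w"
  unfolding surrogate_alt objective_alt
proof (rule sum_mono)
  fix k assume k: "k \<in> UL S"
  note nn = gain_nonneg[OF S E k] interf_nonneg[OF S E k]
  have "2 * v k * sqrt ((1 + w k) * gain S E k) - (v k)\<^sup>2 * (gain S E k + interf S E k)
      \<le> (1 + w k) * gain S E k / (gain S E k + interf S E k)"
  proof (rule quadratic_transform_le)
    have "-1 < w k" using w k by blast
    then show "0 \<le> (1 + w k) * gain S E k" using nn by simp
  qed (use nn in auto)
  then show "2 * v k * sqrt ((1 + w k) * gain S E k) - (v k)\<^sup>2 * (gain S E k + interf S E k)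
      + (ln (1 + w k) - w k)
      \<le> ln (1 + w k) - w k + (1 + w k) * gain S E k / (gain S E k + interf S E k)"
    by linarith
qed

lemma surrogate_quad_step:
  assumes S: "network S" and E: "feasible S E" and w: "\<forall>k \<in> UL S. w k > -1"
  shows "surrogate S w E (quad_step S w E) = objective S E w"
  unfolding surrogate_alt objective_alt
proof (rule sum.cong[OF refl])
  fix k assume k: "k \<in> UL S"
  have "-1 < w k" using w k by blast
  then have "0 \<le> (1 + w k) * gain S E k" using gain_nonneg[OF S E k] by simp
  from quadratic_transform_eq[OF this, of "gain S E k + interf S E k"]
  show "2 * quad_step S w E k * sqrt ((1 + w k) * gain S E k)
      - (quad_step S w E k)\<^sup>2 * (gain S E k + interf S E k) + (ln (1 + w k) - w k)
      = ln (1 + w k) - w k + (1 + w k) * gain S E k / (gain S E k + interf S E k)"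
    by (simp add: quad_step_def)
qed

definition power_coeff :: "('a, 'u) network \<Rightarrow> 'u \<Rightarrow> 'u \<Rightarrow> real" where
  "power_coeff S n k =
     (if n \<in> copilot S k then (real (Nant S) - real (taup S)) * coh S n k else 0) + noncoh S n k"

lemma power_coeff_nonneg:
  assumes "network S" "n \<in> UL S" "k \<in> UL S"
  shows "0 \<le> power_coeff S n k"
  using antenna_margin_pos[OF assms(1)] coh_nonneg[of S n k] noncoh_nonneg[OF assms]
  by (simp add: power_coeff_def)

lemma gain_plus_interf_eq:
  assumes S: "network S" and n: "n \<in> UL S"
  shows "gain S E n + interf S E n = (\<Sum>k \<in> UL S. E k * power_coeff S n k) + eff_noise S n"
proof -
  let ?c = "real (Nant S) - real (taup S)"
  let ?J = "copilot S n \<inter> UL S"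
  have fin: "finite (UL S)" using S by (simp add: network_def)
  have nJ: "n \<in> ?J" "finite ?J" using n fin by (auto simp: copilot_def)
  have "(\<Sum>k \<in> UL S. E k * (if n \<in> copilot S k then ?c * coh S n k else 0))
      = (\<Sum>k \<in> UL S. if k \<in> copilot S n then ?c * (E k * coh S n k) else 0)"
    using n by (intro sum.cong) (auto simp: copilot_def)
  also have "\<dots> = (\<Sum>k \<in> ?J. ?c * (E k * coh S n k))"
    using fin by (simp add: sum.inter_restrict Int_commute)
  also have "\<dots> = ?c * E n * coh S n n + ?c * (\<Sum>i \<in> ?J - {n}. E i * coh S n i)"
    using nJ by (simp add: sum.remove[of ?J n] sum_distrib_left)
  finally show ?thesis
    by (simp add: gain_def interf_def power_coeff_def distrib_left sum.distrib)
qed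

lemma surrogate_separable:
  assumes S: "network S"
  shows "surrogate S w E v =
    (\<Sum>k \<in> UL S. 2 * (v k * sqrt ((1 + w k) * (real (Nant S) - real (taup S)) * coh S k k)) * sqrt (E k)
        - E k * (\<Sum>n \<in> UL S. (v n)\<^sup>2 * power_coeff S n k))
    + (\<Sum>k \<in> UL S. ln (1 + w k) - w k - (v k)\<^sup>2 * eff_noise S k)"
proof -
  have "(\<Sum>n \<in> UL S. (v n)\<^sup>2 * (gain S E n + interf S E n))
      = (\<Sum>n \<in> UL S. (\<Sum>k \<in> UL S. E k * ((v n)\<^sup>2 * power_coeff S n k)) + (v n)\<^sup>2 * eff_noise S n)"
    by (intro sum.cong[OF refl])
      (simp add: gain_plus_interf_eq[OF S] distrib_left sum_distrib_left mult_ac)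
  also have "\<dots> = (\<Sum>k \<in> UL S. E k * (\<Sum>n \<in> UL S. (v n)\<^sup>2 * power_coeff S n k))
      + (\<Sum>n \<in> UL S. (v n)\<^sup>2 * eff_noise S n)"
    by (subst sum.distrib, subst sum.swap) (simp add: sum_distrib_left)
  finally show ?thesis
    unfolding surrogate_def
    by (simp add: sum.distrib sum_subtractf gain_def real_sqrt_mult mult_ac)
qed

lemma stationary_power_eq:
  assumes "network S" "w k > -1"
  shows "stationary_power S w v k =
    (v k * sqrt ((1 + w k) * (real (Nant S) - real (taup S)) * coh S k k)
      / (\<Sum>n \<in> UL S. (v n)\<^sup>2 * power_coeff S n k))\<^sup>2"
  using antenna_margin_pos[OF assms(1)] assms(2) coh_nonneg[of S k k]
  by (simp add: stationary_power_def power_coeff_def power_divide power_mult_distrib)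

lemma surrogate_le_clipped:
  assumes S: "network S" and E: "feasible S E"
    and w: "\<forall>k \<in> UL S. w k > -1" and v: "\<forall>k \<in> UL S. v k \<ge> 0"
  shows "surrogate S w E v \<le> surrogate S w (\<lambda>k. min (stationary_power S w v k) (Emax S)) v"
  unfolding surrogate_separable[OF S]
proof (intro add_right_mono sum_mono)
  fix k assume k: "k \<in> UL S"
  let ?c = "real (Nant S) - real (taup S)"
  let ?a = "v k * sqrt ((1 + w k) * ?c * coh S k k)"
  let ?d = "\<Sum>n \<in> UL S. (v n)\<^sup>2 * power_coeff S n k"
  have fin: "finite (UL S)" using S by (simp add: network_def)
  have c: "?c > 0" using antenna_margin_pos[OF S] .
  have wk: "w k > -1" using w k by blast
  have nn: "0 \<le> (v n)\<^sup>2 * power_coeff S n k" if "n \<in> UL S" for n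
    using power_coeff_nonneg[OF S that k] by simp
  have d0: "0 \<le> ?d" using nn by (rule sum_nonneg)
  have a0: "0 \<le> ?a" using v k wk c coh_nonneg[of S k k] by (intro mult_nonneg_nonneg) auto
  have "?a = 0" if "?d = 0"
  proof -
    have "(v k)\<^sup>2 * power_coeff S k k = 0"
      using that sum_nonneg_eq_0_iff[OF fin, of "\<lambda>n. (v n)\<^sup>2 * power_coeff S n k"] nn k by blast
    moreover have "?c * coh S k k \<le> power_coeff S k k"
      using k noncoh_nonneg[OF S k k] by (simp add: power_coeff_def copilot_def)
    ultimately have "v k = 0 \<or> ?c * coh S k k \<le> 0" by auto
    then show ?thesis using c coh_nonneg[of S k k] by (auto simp: mult_le_0_iff)
  qed
  with clipped_sqrt_maximizer[OF a0 d0, of "E k" "Emax S"] E k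
  show "2 * ?a * sqrt (E k) - E k * ?d
      \<le> 2 * ?a * sqrt (min (stationary_power S w v k) (Emax S))
        - min (stationary_power S w v k) (Emax S) * ?d"
    by (simp add: stationary_power_eq[of S w k v, OF S wk] feasible_def)
qed

lemma feasible_power_step:
  assumes S: "network S" and E: "feasible S E"
  shows "feasible S (power_step S E)"
proof -
  have "0 \<le> stationary_power S w v k" for w v k
    using antenna_margin_pos[OF S] coh_nonneg[of S k k]
    unfolding stationary_power_def by (intro divide_nonneg_nonneg mult_nonneg_nonneg) auto
  moreover have "0 \<le> Emax S" if "k \<in> UL S" for k
    using E that by (force simp: feasible_def)
  ultimately show ?thesis by (auto simp: feasible_def power_step_def Let_def)
qed

lemma objective_le_power_step:
  assumes S: "network S" and E: "feasible S E"
  shows "objective S E (sinr_step S E) \<le> objective S (power_step S E) (sinr_step S E)"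
proof -
  let ?w = "sinr_step S E"
  let ?v = "quad_step S ?w E"
  have w: "\<forall>k \<in> UL S. ?w k > -1" using sinr_step_nonneg[OF S E] by force
  have v: "\<forall>k \<in> UL S. ?v k \<ge> 0"
    using gain_nonneg[OF S E] interf_nonneg[OF S E] sinr_step_nonneg[OF S E]
    by (auto simp: quad_step_def)
  have "objective S E ?w = surrogate S ?w E ?v"
    using surrogate_quad_step[OF S E w] by simp
  also have "\<dots> \<le> surrogate S ?w (power_step S E) ?v"
    using surrogate_le_clipped[OF S E w v] by (simp add: power_step_def Let_def)
  also have "\<dots> \<le> objective S (power_step S E) ?w"
    by (rule surrogate_le_objective[OF S feasible_power_step[OF S E] w])
  finally show ?thesis .
qed

lemma feasible_powers:
  assumes "network S" "feasible S E0"
  shows "feasible S (powers S E0 i)"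
  using assms by (induction i) (auto intro: feasible_power_step)

lemma auxvars_gt:
  assumes "network S" "feasible S E0" "\<forall>k \<in> UL S. w0 k > -1"
  shows "\<forall>k \<in> UL S. auxvars S E0 w0 i k > -1"
proof (cases i)
  case (Suc j)
  have "-1 < sinr_step S (powers S E0 j) k" if "k \<in> UL S" for k
    using sinr_step_nonneg[OF assms(1) feasible_powers[OF assms(1,2)] that, of j] by linarith
  then show ?thesis using Suc by simp
qed (use assms in simp)

lemma incseq_objective_seq:
  assumes S: "network S" and E0: "feasible S E0" and w0: "\<forall>k \<in> UL S. w0 k > -1"
  shows "incseq (objective_seq S E0 w0)"
proof (rule incseq_SucI)
  fix i
  show "objective_seq S E0 w0 i \<le> objective_seq S E0 w0 (Suc i)"
    unfolding objective_seq_def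
    using objective_le_sinr_step[OF S feasible_powers[OF S E0] auxvars_gt[OF S E0 w0], of i i]
      objective_le_power_step[OF S feasible_powers[OF S E0], of i]
    by simp
qed

theorem proposition3:
  fixes S :: "('a, 'u) network" and E0 w0 :: "'u \<Rightarrow> real"
  assumes "network S"
    and "feasible S E0"
    and "\<forall>k \<in> UL S. w0 k > -1"
  shows "(\<exists>B. \<forall>E w. feasible S E \<longrightarrow> (\<forall>k \<in> UL S. w k > -1) \<longrightarrow> objective S E w \<le> B)
    \<and> bdd_above (range (objective_seq S E0 w0))
    \<and> (\<forall>i. objective_seq S E0 w0 i \<le> objective_seq S E0 w0 (Suc i))
    \<and> convergent (objective_seq S E0 w0)
    \<and> (\<forall>\<delta>>0. \<exists>i. \<bar>objective_seq S E0 w0 (Suc i) - objective_seq S E0 w0 i\<bar> < \<delta>)"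
proof -
  let ?f = "objective_seq S E0 w0"
  obtain B where B: "\<forall>E w. feasible S E \<longrightarrow> (\<forall>k \<in> UL S. w k > -1) \<longrightarrow> objective S E w \<le> B"
    using objective_le_capacity[OF assms(1)] by blast
  have le: "?f i \<le> B" for i
    unfolding objective_seq_def using B feasible_powers[OF assms(1,2)] auxvars_gt[OF assms] by blast
  then have bdd: "bdd_above (range ?f)" by (intro bdd_aboveI[of _ B]) auto
  have inc: "incseq ?f" using incseq_objective_seq[OF assms] .
  obtain L where L: "?f \<longlonglongrightarrow> L" using incseq_convergent[OF inc] le by blast
  then have "(\<lambda>i. ?f (Suc i) - ?f i) \<longlonglongrightarrow> 0"
    using tendsto_diff[OF LIMSEQ_Suc[OF L] L] by simp
  then have "\<exists>i. \<bar>?f (Suc i) - ?f i\<bar> < \<delta>" if "\<delta> > 0" for \<delta>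
    using that by (fastforce simp: LIMSEQ_iff)
  then show ?thesis
    using B bdd inc L by (auto simp: incseq_Suc_iff convergent_def)
qed

end
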